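(* A nonnegative matrix $M$ with $\operatorname{rank}(M)\ge 2$ is a slack matrix of a polyhedral cone if and only if $M_{\mathrm{inc}}$ is an incidence matrix of some $\operatorname{rank}(M)$-dimensional pointed polyhedral cone.
   Context: A matrix $S\in\mathbb{R}^{p\times q}$ is a slack matrix of a polyhedral cone $K\subseteq\mathbb{R}^n$ if there are $A\in\mathbb{R}^{p\times n}$, $B\in\mathbb{R}^{n\times q}$ with $K=\{x\in\mathbb{R}^n: x^TB\ge 0\}=\{y^TA: y\in\mathbb{R}_+^p\}$ and $S=AB$. For a matrix $M$, $M_{\mathrm{inc}}$ is the $0/1$-matrix with $(M_{\mathrm{inc}})_{ij}=1$ iff $M_{ij}=0$. An incidence matrix of a polyhedral cone $K$ is a matrix $S_{\mathrm{inc}}$ for some slack matrix $S$ of $K$. A cone is pointed if its lineality space is $\{0\}$; its dimension is the dimension of its linear span. *)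

theory Defs
  imports "Jordan_Normal_Form.DL_Rank"
begin

definition slack_matrix_of :: "nat \<Rightarrow> real vec set \<Rightarrow> real mat \<Rightarrow> bool" where
  "slack_matrix_of n K S \<longleftrightarrow>
     (\<exists>A B. A \<in> carrier_mat (dim_row S) n \<and> B \<in> carrier_mat n (dim_col S) \<and>
        K = {x \<in> carrier_vec n. \<forall>j < dim_col S. x \<bullet> col B j \<ge> 0} \<and>
        K = {transpose_mat A *\<^sub>v y | y. y \<in> carrier_vec (dim_row S) \<and> (\<forall>i < dim_row S. y $ i \<ge> 0)} \<and>
        S = A * B)"

definition is_slack_matrix :: "real mat \<Rightarrow> bool" where
  "is_slack_matrix S \<longleftrightarrow> (\<exists>n K. slack_matrix_of n K S)"

definition inc_mat :: "real mat \<Rightarrow> real mat" where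
  "inc_mat M = mat (dim_row M) (dim_col M) (\<lambda>(i,j). if M $$ (i,j) = 0 then 1 else 0)"

definition incidence_matrix_of :: "nat \<Rightarrow> real vec set \<Rightarrow> real mat \<Rightarrow> bool" where
  "incidence_matrix_of n K N \<longleftrightarrow> (\<exists>S. slack_matrix_of n K S \<and> N = inc_mat S)"

definition polyhedral_cone :: "nat \<Rightarrow> real vec set \<Rightarrow> bool" where
  "polyhedral_cone n K \<longleftrightarrow> (\<exists>q B. B \<in> carrier_mat n q \<and>
      K = {x \<in> carrier_vec n. \<forall>j < q. x \<bullet> col B j \<ge> 0})"

definition pointed_cone :: "nat \<Rightarrow> real vec set \<Rightarrow> bool" where
  "pointed_cone n K \<longleftrightarrow> {x \<in> K. - x \<in> K} = {0\<^sub>v n}"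

definition (in vec_space) cone_dim :: "'a vec set \<Rightarrow> nat" where
  "cone_dim K = vectorspace.dim class_ring (span_vs K)"

end

theory Submission
  imports Defs "HOL-Library.Function_Algebras"
begin

text \<open>
  A nonnegative matrix is a slack matrix iff every nonnegative vector in its row space is a nonnegative
  combination of its rows. For such an \<open>M\<close>, a rank factorization \<open>M = C T\<close> exhibits \<open>M\<close> as a slack
  matrix of the pointed cone \<open>{x. x\<^sup>T T \<ge> 0}\<close> of dimension \<open>rank M\<close>, which gives one direction.

  Conversely, let \<open>S\<close> be a slack matrix of a pointed cone of dimension \<open>rank M\<close> with the zero pattern
  of \<open>M\<close>. Along a maximal chain of faces of the cone the rank of the rows of \<open>S\<close> on the faces grows
  by one in each step, while for \<open>M\<close> it grows by at least one; as the total ranks agree, the rows on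
  each face have the same rank in \<open>S\<close> and in \<open>M\<close>. Hence a vector in the \<open>M\<close>-span of a face that
  vanishes in the column of a facet lies in the \<open>M\<close>-span of this facet, and induction over the faces
  shows that \<open>M\<close> has the slack property too.
\<close>

section \<open>Row spaces and row cones\<close>

context vector_space
begin

lemma dim_insert_notin_span:
  assumes "finite G" and "a \<notin> span G"
  shows "dim (insert a G) = dim G + 1"
proof -
  obtain B where B: "B \<subseteq> G" "independent B" "G \<subseteq> span B" "card B = dim G"
    using basis_exists[of G] by blast
  have sp: "span B = span G"
    using span_mono[OF B(1)] span_minimal[OF B(3) subspace_span] by blast
  have "independent (insert a B)" and "a \<notin> B"
    using B(2) assms(2) sp by (auto simp: independent_insert span_base)
  moreover have "span (insert a B) = span (insert a G)"
    using sp by (simp add: span_insert)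
  moreover have "finite B"
    using B(1) assms(1) finite_subset by blast
  ultimately show ?thesis
    using B(4) by (metis Suc_eq_plus1 card_insert_disjoint dim_eq_card)
qed

lemma dim_mono_finite:
  assumes "V \<subseteq> span W" and "finite W"
  shows "dim V \<le> dim W"
proof -
  obtain B where B: "B \<subseteq> W" "independent B" "W \<subseteq> span B" "card B = dim W"
    using basis_exists[of W] by blast
  have "V \<subseteq> span B"
    using B(3) assms(1) using span_minimal[OF B(3) subspace_span] by blast
  then show ?thesis
    using dim_le_card[of V B] B(4) finite_subset[OF B(1) assms(2)] by simp
qed

text \<open>A vector of \<open>F\<close> missing from the span of \<open>G\<close> could be added to
  \<open>G\<close>, giving a subset of the span of \<open>F\<close> of too large a
  dimension.\<close>

lemma span_eq_of_dim_le:
  assumes "finite F" and "G \<subseteq> span F" and "finite G" and "dim F \<le> dim G"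
  shows "span G = span F"
proof
  show "span G \<subseteq> span F"
    using assms(2) by (simp add: span_minimal)
  have "F \<subseteq> span G"
  proof (rule ccontr)
    assume "\<not> F \<subseteq> span G"
    then obtain a where a: "a \<in> F" "a \<notin> span G" by blast
    have "insert a G \<subseteq> span F"
      using a(1) assms(2) by (simp add: span_base)
    then have "dim (insert a G) \<le> dim F"
      using assms(1) by (rule dim_mono_finite)
    then show False
      using dim_insert_notin_span[OF assms(3) a(2)] assms(4) by simp
  qed
  then show "span F \<subseteq> span G"
    by (simp add: span_minimal)
qed

end

text \<open>Rows are functions on the column index, so span and dimension come from the locale
  \<open>vector_space\<close> without carrier conditions.\<close>

interpretation fun_vs: vector_space "\<lambda>(c::real) (f::'j \<Rightarrow> real) j. c * f j"
  by unfold_locales (auto simp: fun_eq_iff algebra_simps)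

lemma sum_fun_apply: "(\<Sum>i\<in>I. f i) j = (\<Sum>i\<in>I. f i j :: real)"
  by (induction I rule: infinite_finite_induct) auto

text \<open>Coefficients belong to row indices, not to vectors, so repeated rows need no care. The
  combinations form a subspace containing all rows.\<close>

lemma in_row_span_iff:
  fixes R :: "'i \<Rightarrow> 'j \<Rightarrow> real"
  assumes "finite F"
  shows "x \<in> fun_vs.span (R ` F) \<longleftrightarrow> (\<exists>u. x = (\<lambda>j. \<Sum>i\<in>F. u i * R i j))"
proof
  let ?T = "{x. \<exists>u. x = (\<lambda>j. \<Sum>i\<in>F. u i * R i j)}"
  have "fun_vs.subspace ?T"
  proof (rule fun_vs.subspaceI)
    show "0 \<in> ?T"
      by (auto intro!: exI[of _ "\<lambda>_. 0"] simp: fun_eq_iff)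
  next
    fix x y assume "x \<in> ?T" "y \<in> ?T"
    then obtain u v where "x = (\<lambda>j. \<Sum>i\<in>F. u i * R i j)" "y = (\<lambda>j. \<Sum>i\<in>F. v i * R i j)"
      by blast
    then show "x + y \<in> ?T"
      by (auto intro!: exI[of _ "\<lambda>i. u i + v i"] simp: fun_eq_iff sum.distrib algebra_simps)
  next
    fix c x assume "x \<in> ?T"
    then obtain u where "x = (\<lambda>j. \<Sum>i\<in>F. u i * R i j)" by blast
    then show "(\<lambda>j. c * x j) \<in> ?T"
      by (auto intro!: exI[of _ "\<lambda>i. c * u i"] simp: fun_eq_iff sum_distrib_left algebra_simps)
  qed
  moreover have "R ` F \<subseteq> ?T"
  proof
    fix x assume "x \<in> R ` F"
    then obtain k where k: "k \<in> F" "x = R k" by blast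
    have "x j = (\<Sum>i\<in>F. (if i = k then 1 else 0) * R i j)" for j
      using k assms by (simp add: if_distrib[of "\<lambda>c. c * _"] sum.delta cong: if_cong)
    then have "x = (\<lambda>j. \<Sum>i\<in>F. (if i = k then 1 else 0) * R i j)" by blast
    then show "x \<in> ?T" by (intro CollectI exI)
  qed
  ultimately have "fun_vs.span (R ` F) \<subseteq> ?T"
    by (rule fun_vs.span_minimal[rotated])
  then show "x \<in> fun_vs.span (R ` F) \<Longrightarrow> \<exists>u. x = (\<lambda>j. \<Sum>i\<in>F. u i * R i j)"
    by blast
next
  assume "\<exists>u. x = (\<lambda>j. \<Sum>i\<in>F. u i * R i j)"
  then obtain u where "x = (\<lambda>j. \<Sum>i\<in>F. u i * R i j)" by blast
  then have "x = (\<Sum>i\<in>F. (\<lambda>j. u i * R i j))"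
    by (simp add: fun_eq_iff sum_fun_apply)
  also have "\<dots> \<in> fun_vs.span (R ` F)"
    by (intro fun_vs.span_sum fun_vs.span_scale fun_vs.span_base) auto
  finally show "x \<in> fun_vs.span (R ` F)" .
qed

lemma row_span_vanish:
  fixes R :: "'i \<Rightarrow> 'j \<Rightarrow> real"
  assumes "finite F" and "x \<in> fun_vs.span (R ` F)" and "\<And>i. i \<in> F \<Longrightarrow> R i j = 0"
  shows "x j = 0"
  using assms by (auto simp: in_row_span_iff)

section \<open>Cones generated by rows\<close>

definition row_cone :: "('i \<Rightarrow> 'j \<Rightarrow> real) \<Rightarrow> 'i set \<Rightarrow> ('j \<Rightarrow> real) set" where
  "row_cone R F = {x. \<exists>y. (\<forall>i\<in>F. 0 \<le> y i) \<and> x = (\<lambda>j. \<Sum>i\<in>F. y i * R i j)}"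

lemma row_cone_mono:
  assumes "finite F" and "G \<subseteq> F" and "x \<in> row_cone R G"
  shows "x \<in> row_cone R F"
proof -
  obtain y where y: "\<forall>i\<in>G. 0 \<le> y i" "x = (\<lambda>j. \<Sum>i\<in>G. y i * R i j)"
    using assms(3) unfolding row_cone_def by blast
  have "(\<Sum>i\<in>G. y i * R i j) = (\<Sum>i\<in>F. (if i \<in> G then y i else 0) * R i j)" for j
    by (rule sum.mono_neutral_cong_left) (use assms in auto)
  then show ?thesis
    unfolding row_cone_def y(2)
    by (intro CollectI exI[of _ "\<lambda>i. if i \<in> G then y i else 0"]) (use y(1) in auto)
qed

lemma row_cone_add_scaled_row:
  assumes "finite F" and "a \<in> F" and "x \<in> row_cone R F" and "0 \<le> t"
  shows "(\<lambda>j. x j + t * R a j) \<in> row_cone R F"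
proof -
  obtain y where y: "\<forall>i\<in>F. 0 \<le> y i" "x = (\<lambda>j. \<Sum>i\<in>F. y i * R i j)"
    using assms(3) unfolding row_cone_def by blast
  have "(\<Sum>i\<in>F. (y i + (if i = a then t else 0)) * R i j) = x j + t * R a j" for j
    using assms(1,2)
    by (simp add: y(2) algebra_simps sum.distrib if_distrib[of "\<lambda>c. _ * c"] sum.delta cong: if_cong)
  then show ?thesis
    unfolding row_cone_def
    by (intro CollectI exI[of _ "\<lambda>i. y i + (if i = a then t else 0)"]) (use y(1) assms(4) in auto)
qed

lemma row_cone_subset_span:
  "finite F \<Longrightarrow> row_cone R F \<subseteq> fun_vs.span (R ` F)"
  by (auto simp: row_cone_def in_row_span_iff)

text \<open>For nonnegative rows the reverse inclusion is automatic. No factorization or ambient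
  dimension occurs, so the property can be carried from one matrix to another.\<close>

definition slack_rows :: "'i set \<Rightarrow> 'j set \<Rightarrow> ('i \<Rightarrow> 'j \<Rightarrow> real) \<Rightarrow> bool" where
  "slack_rows P Q R \<longleftrightarrow>
    (\<forall>x \<in> fun_vs.span (R ` P). (\<forall>j\<in>Q. 0 \<le> x j) \<longrightarrow> x \<in> row_cone R P)"

section \<open>Faces of a zero pattern\<close>

text \<open>Only the zero pattern is fixed, so two matrices with this pattern share their faces and
  facets.\<close>

locale incidence =
  fixes P :: "'i set" and Q :: "'j set" and Z :: "'j \<Rightarrow> 'i set"
  assumes finite_P: "finite P" and finite_Q: "finite Q"
begin

text \<open>A face of the cone generated by the rows is encoded by the set of rows lying on it, \<open>Z j\<close>
  being the set of rows that vanish in column \<open>j\<close>; \<open>facet F j\<close> says that column \<open>j\<close> cuts a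
  maximal proper face \<open>F \<inter> Z j\<close> out of \<open>F\<close>.\<close>

definition face :: "'i set \<Rightarrow> bool" where
  "face F \<longleftrightarrow> F \<subseteq> P \<and> (\<forall>i\<in>P. (\<forall>j\<in>Q. F \<subseteq> Z j \<longrightarrow> i \<in> Z j) \<longrightarrow> i \<in> F)"

definition facet :: "'i set \<Rightarrow> 'j \<Rightarrow> bool" where
  "facet F j \<longleftrightarrow> j \<in> Q \<and> \<not> F \<subseteq> Z j \<and>
     (\<forall>k\<in>Q. F \<inter> Z j \<subseteq> Z k \<longrightarrow> \<not> F \<subseteq> Z k \<longrightarrow> F \<inter> Z k \<subseteq> Z j)"

text \<open>Entries outside \<open>Q\<close> vanish so that functions in the span are determined by
  their values on \<open>Q\<close>.\<close>

definition realized_by :: "('i \<Rightarrow> 'j \<Rightarrow> real) \<Rightarrow> bool" where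
  "realized_by R \<longleftrightarrow> (\<forall>i\<in>P. \<forall>j. j \<notin> Q \<longrightarrow> R i j = 0) \<and>
     (\<forall>i\<in>P. \<forall>j\<in>Q. 0 \<le> R i j \<and> (R i j = 0 \<longleftrightarrow> i \<in> Z j))"

lemma face_P: "face P"
  by (auto simp: face_def)

lemma face_subset: "face F \<Longrightarrow> F \<subseteq> P"
  by (simp add: face_def)

lemma face_finite: "face F \<Longrightarrow> finite F"
  using face_subset finite_P finite_subset by blast

text \<open>Column \<open>j\<close> and all columns vanishing on \<open>F\<close> also vanish on
  \<open>F \<inter> Z j\<close>, so a row in the closure of the intersection lies in both
  sets.\<close>

lemma face_Int: "face F \<Longrightarrow> j \<in> Q \<Longrightarrow> face (F \<inter> Z j)"
  unfolding face_def by blast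

lemma facet_in_Q: "facet F j \<Longrightarrow> j \<in> Q"
  by (simp add: facet_def)

text \<open>Take a maximal one among the finitely many proper cuts of \<open>F\<close> by
  columns.\<close>

lemma facet_exists:
  assumes "k \<in> Q" and "\<not> F \<subseteq> Z k"
  obtains j where "facet F j"
proof -
  let ?A = "(\<lambda>j. F \<inter> Z j) ` {j \<in> Q. \<not> F \<subseteq> Z j}"
  have "finite ?A" and "F \<inter> Z k \<in> ?A"
    using assms finite_Q by auto
  then obtain G where G: "G \<in> ?A" "\<forall>B\<in>?A. G \<subseteq> B \<longrightarrow> G = B"
    by (rule finite_has_maximal2[elim_format]) blast
  then obtain j where j: "j \<in> Q" "\<not> F \<subseteq> Z j" "G = F \<inter> Z j" by blast
  have "facet F j"
    unfolding facet_def
  proof (intro conjI ballI impI)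
    fix l assume "l \<in> Q" "F \<inter> Z j \<subseteq> Z l" "\<not> F \<subseteq> Z l"
    then have "F \<inter> Z l \<in> ?A" "G \<subseteq> F \<inter> Z l"
      using j(3) by auto
    then have "G = F \<inter> Z l"
      using G(2) by blast
    then show "F \<inter> Z l \<subseteq> Z j"
      using j(3) by blast
  qed (use j in auto)
  then show ?thesis using that by blast
qed

lemma face_psubset_separated:
  assumes "face G" and "face F" and "G \<subset> F"
  obtains j a where "j \<in> Q" "G \<subseteq> Z j" "a \<in> F" "a \<notin> Z j"
  using assms unfolding face_def by blast

section \<open>Row spans of the faces for a realization of the pattern\<close>

lemma realized_pos:
  "realized_by R \<Longrightarrow> i \<in> P \<Longrightarrow> j \<in> Q \<Longrightarrow> i \<notin> Z j \<Longrightarrow> 0 < R i j"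
  unfolding realized_by_def by (metis order_le_less)

lemma realized_zero:
  "realized_by R \<Longrightarrow> i \<in> P \<Longrightarrow> j \<in> Q \<Longrightarrow> i \<in> Z j \<Longrightarrow> R i j = 0"
  unfolding realized_by_def by blast

lemma realized_nonneg:
  "realized_by R \<Longrightarrow> i \<in> P \<Longrightarrow> j \<in> Q \<Longrightarrow> 0 \<le> R i j"
  unfolding realized_by_def by blast

lemma realized_span_vanish:
  assumes "realized_by R" and "F \<subseteq> P" and "j \<in> Q" and "F \<subseteq> Z j" and "x \<in> fun_vs.span (R ` F)"
  shows "x j = 0"
proof (rule row_span_vanish[OF _ assms(5)])
  show "finite F" using assms(2) finite_P finite_subset by blast
  show "R i j = 0" if "i \<in> F" for i
    using that realized_zero[OF assms(1)] assms(2-4) by blast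
qed

text \<open>A column that vanishes on \<open>G\<close> but not at a row of \<open>F\<close> keeps
  this row out of the span of \<open>G\<close>.\<close>

lemma dim_face_less:
  assumes "realized_by R" and "face G" and "face F" and "G \<subset> F"
  shows "fun_vs.dim (R ` G) + 1 \<le> fun_vs.dim (R ` F)"
proof -
  obtain j a where ja: "j \<in> Q" "G \<subseteq> Z j" "a \<in> F" "a \<notin> Z j"
    using face_psubset_separated[OF assms(2-4)] .
  have "R a \<notin> fun_vs.span (R ` G)"
    using realized_span_vanish[OF assms(1) face_subset[OF assms(2)] ja(1,2)]
      realized_pos[OF assms(1) _ ja(1,4)] face_subset[OF assms(3)] ja(3) by fastforce
  then have "fun_vs.dim (insert (R a) (R ` G)) = fun_vs.dim (R ` G) + 1"
    using fun_vs.dim_insert_notin_span face_finite[OF assms(2)] by blast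
  moreover have "insert (R a) (R ` G) \<subseteq> fun_vs.span (R ` F)"
    using ja(3) assms(4) by (auto intro: fun_vs.span_base)
  then have "fun_vs.dim (insert (R a) (R ` G)) \<le> fun_vs.dim (R ` F)"
    using face_finite[OF assms(3)] by (intro fun_vs.dim_mono_finite) auto
  ultimately show ?thesis by simp
qed

text \<open>Row \<open>a\<close> is outside the span of the cut, and the dimension drops by at most
  one, so row \<open>a\<close> and the rows of the cut already span everything.\<close>

lemma facet_span_decompose:
  assumes R: "realized_by R" and F: "face F" and j: "j \<in> Q" and a: "a \<in> F" "a \<notin> Z j"
    and dim: "fun_vs.dim (R ` F) \<le> fun_vs.dim (R ` (F \<inter> Z j)) + 1"
    and x: "x \<in> fun_vs.span (R ` F)"
  obtains c where "(\<lambda>k. x k - c * R a k) \<in> fun_vs.span (R ` (F \<inter> Z j))"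
proof -
  let ?G = "F \<inter> Z j"
  have fin: "finite F" "finite ?G"
    using face_finite[OF F] by auto
  have "R a \<notin> fun_vs.span (R ` ?G)"
    using realized_span_vanish[OF R _ j, of ?G "R a"] realized_pos[OF R _ j a(2)]
      face_subset[OF F] a(1) by fastforce
  then have "fun_vs.dim (insert (R a) (R ` ?G)) = fun_vs.dim (R ` ?G) + 1"
    using fun_vs.dim_insert_notin_span fin by blast
  then have "fun_vs.span (insert (R a) (R ` ?G)) = fun_vs.span (R ` F)"
    using a(1) fin dim by (intro fun_vs.span_eq_of_dim_le) (auto intro: fun_vs.span_base)
  then have "x \<in> fun_vs.span (insert (R a) (R ` ?G))"
    using x by simp
  then obtain c where "x - (\<lambda>k. c * R a k) \<in> fun_vs.span (R ` ?G)"
    by (auto simp: fun_vs.span_insert)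
  moreover have "x - (\<lambda>k. c * R a k) = (\<lambda>k. x k - c * R a k)"
    by (simp add: fun_eq_iff)
  ultimately show ?thesis using that by simp
qed

text \<open>Column \<open>j\<close> forces the coefficient of row \<open>a\<close> to be zero. The
  dimension bound takes the place of the slack property, which is not yet known for
  \<open>M\<close>.\<close>

lemma facet_span_of_dim:
  assumes R: "realized_by R" and F: "face F" and j: "facet F j"
    and dim: "fun_vs.dim (R ` F) \<le> fun_vs.dim (R ` (F \<inter> Z j)) + 1"
    and x: "x \<in> fun_vs.span (R ` F)" and xj: "x j = 0"
  shows "x \<in> fun_vs.span (R ` (F \<inter> Z j))"
proof -
  have jQ: "j \<in> Q" using j by (rule facet_in_Q)
  obtain a where a: "a \<in> F" "a \<notin> Z j"
    using j unfolding facet_def by blast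
  obtain c where c: "(\<lambda>k. x k - c * R a k) \<in> fun_vs.span (R ` (F \<inter> Z j))"
    using facet_span_decompose[OF R F jQ a dim x] .
  have "x j - c * R a j = 0"
    using realized_span_vanish[OF R _ jQ _ c] face_subset[OF F] by blast
  then have "c = 0"
    using realized_pos[OF R _ jQ a(2)] face_subset[OF F] a(1) xj by fastforce
  then show ?thesis using c by simp
qed

text \<open>A vector that is admissible near the face \<open>H\<close> becomes admissible after adding a large
  multiple of a relative interior point of \<open>H\<close>.\<close>

lemma slack_lift:
  assumes S: "realized_by S" and sl: "slack_rows P Q S" and F: "face F" and H: "H \<subseteq> F"
    and w: "w \<in> fun_vs.span (S ` F)" and wnn: "\<And>j. j \<in> Q \<Longrightarrow> H \<subseteq> Z j \<Longrightarrow> 0 \<le> w j"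
    and k: "k \<in> Q" "H \<subseteq> Z k" "w k = 0"
  obtains N where "(\<lambda>j. w j + N * (\<Sum>i\<in>H. S i j)) \<in> row_cone S (F \<inter> Z k)"
proof -
  define z where "z = (\<lambda>j. \<Sum>i\<in>H. S i j)"
  \<comment> \<open>The sum dominates each quotient. Columns with \<open>z j = 0\<close> contribute
    0; they are those vanishing on \<open>H\<close>, where \<open>w\<close> is nonnegative by
    assumption.\<close>
  define N where "N = (\<Sum>j\<in>Q. \<bar>w j\<bar> / z j)"
  define x where "x = (\<lambda>j. w j + N * z j)"
  have FP: "F \<subseteq> P" and HP: "H \<subseteq> P" and fH: "finite H"
    using face_subset[OF F] H face_finite[OF F] finite_subset by auto
  have z0: "z j = 0" if "j \<in> Q" "H \<subseteq> Z j" for j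
    unfolding z_def by (rule sum.neutral) (use realized_zero[OF S _ that(1)] HP that(2) in blast)
  have znn: "0 \<le> z j" if "j \<in> Q" for j
    unfolding z_def by (rule sum_nonneg) (use realized_nonneg[OF S _ that] HP in blast)
  have zpos: "0 < z j" if j: "j \<in> Q" "\<not> H \<subseteq> Z j" for j
  proof -
    obtain h where h: "h \<in> H" "h \<notin> Z j" using j by blast
    show ?thesis unfolding z_def
      using realized_pos[OF S _ j(1) h(2)] realized_nonneg[OF S _ j(1)] h(1) HP fH
      by (intro sum_pos2[of _ h]) auto
  qed
  have xnn: "0 \<le> x j" if j: "j \<in> Q" for j
  proof (cases "H \<subseteq> Z j")
    case True
    then show ?thesis using z0 wnn j unfolding x_def by simp
  next
    case False
    then have zj: "0 < z j" using zpos j by blast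
    have "\<bar>w j\<bar> / z j \<le> N"
      unfolding N_def using znn by (intro member_le_sum[OF j] finite_Q) auto
    then have "\<bar>w j\<bar> \<le> N * z j" using zj by (simp add: field_simps)
    then show ?thesis unfolding x_def by linarith
  qed
  have "z \<in> fun_vs.span (S ` F)"
  proof -
    have "z = (\<Sum>i\<in>H. S i)" by (simp add: z_def fun_eq_iff sum_fun_apply)
    also have "\<dots> \<in> fun_vs.span (S ` F)"
      using H by (intro fun_vs.span_sum fun_vs.span_base) auto
    finally show ?thesis .
  qed
  then have "w + (\<lambda>j. N * z j) \<in> fun_vs.span (S ` F)"
    using w by (intro fun_vs.span_add fun_vs.span_scale)
  then have xF: "x \<in> fun_vs.span (S ` F)"
    by (simp add: x_def plus_fun_def)
  then have "x \<in> fun_vs.span (S ` P)"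
    using fun_vs.span_mono[OF image_mono[OF FP]] by blast
  then obtain y where y: "\<forall>i\<in>P. 0 \<le> y i" "x = (\<lambda>j. \<Sum>i\<in>P. y i * S i j)"
    using sl xnn unfolding slack_rows_def row_cone_def by blast
  have y0: "y i = 0" if i: "i \<in> P" "i \<notin> Z j" and j: "j \<in> Q" "x j = 0" for i j
  proof -
    have "(\<Sum>i\<in>P. y i * S i j) = 0" using j(2) y(2) by metis
    then have "y i * S i j = 0"
      using i(1) y(1) realized_nonneg[OF S _ j(1)] finite_P
      by (subst (asm) sum_nonneg_eq_0_iff) auto
    then show ?thesis using realized_pos[OF S i(1) j(1) i(2)] by simp
  qed
  \<comment> \<open>The slack property yields coefficients on all of \<open>P\<close>. A row of
    \<open>F\<close> off \<open>Z k\<close> is excluded by column \<open>k\<close>, where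
    \<open>w\<close> and \<open>z\<close> vanish; a row outside \<open>F\<close> is excluded by a
    column vanishing on \<open>F\<close>, hence at \<open>x\<close>.\<close>
  have supp: "y i = 0" if i: "i \<in> P" "i \<notin> F \<inter> Z k" for i
  proof (cases "i \<in> F")
    case True
    then show ?thesis using y0[OF i(1) _ k(1)] i(2) k z0 unfolding x_def by auto
  next
    case False
    then obtain j where j: "j \<in> Q" "F \<subseteq> Z j" "i \<notin> Z j"
      using F i(1) unfolding face_def by blast
    then show ?thesis
      using y0[OF i(1) j(3) j(1)] realized_span_vanish[OF S FP j(1,2) xF] by blast
  qed
  have "(\<Sum>i\<in>P. y i * S i j) = (\<Sum>i\<in>F \<inter> Z k. y i * S i j)" for j
    using supp FP by (intro sum.mono_neutral_right finite_P) auto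
  then have "x = (\<lambda>j. \<Sum>i\<in>F \<inter> Z k. y i * S i j)"
    unfolding y(2) by simp
  then have "x \<in> row_cone S (F \<inter> Z k)"
    unfolding row_cone_def using y(1) FP by blast
  then show ?thesis
    using that unfolding x_def z_def by blast
qed

text \<open>Starting at \<open>v\<close>, move along a row off the facet until the first column vanishing on the facet
  becomes tight. The point reached lies in the span of the facet, so the move had length zero.\<close>

lemma slack_facet_span:
  assumes S: "realized_by S" and sl: "slack_rows P Q S" and F: "face F" and j: "facet F j"
    and v: "v \<in> fun_vs.span (S ` F)" and vj: "v j = 0"
  shows "v \<in> fun_vs.span (S ` (F \<inter> Z j))"
proof -
  let ?G = "F \<inter> Z j"
  have FP: "F \<subseteq> P" and fG: "finite ?G"
    using face_subset[OF F] face_finite[OF F] by auto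
  have jQ: "j \<in> Q" using j by (rule facet_in_Q)
  obtain a where a: "a \<in> F" "a \<notin> Z j"
    using j unfolding facet_def by blast
  \<comment> \<open>These are the columns that cut exactly the facet \<open>?G\<close> out of
    \<open>F\<close>.\<close>
  define J where "J = {k \<in> Q. ?G \<subseteq> Z k \<and> \<not> F \<subseteq> Z k}"
  have J: "finite J" "j \<in> J"
    using finite_Q jQ a unfolding J_def by auto
  have FJ: "F \<inter> Z k \<subseteq> ?G" if "k \<in> J" for k
    using that j unfolding J_def facet_def by blast
  have apos: "0 < S a k" if "k \<in> J" for k
    using FJ[OF that] that a FP by (intro realized_pos[OF S]) (auto simp: J_def)
  \<comment> \<open>The least \<open>s\<close> for which \<open>v + s * S a\<close> is nonnegative
    in all columns of \<open>J\<close>; it is tight at \<open>k\<close>.\<close>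
  define s where "s = Max ((\<lambda>k. - v k / S a k) ` J)"
  have "s \<in> (\<lambda>k. - v k / S a k) ` J"
    unfolding s_def using J by (intro Max_in) auto
  then obtain k where k: "k \<in> J" "s = - v k / S a k" by blast
  have sge: "- v l / S a l \<le> s" if "l \<in> J" for l
    unfolding s_def using J that by (intro Max_ge) auto
  define w where "w = (\<lambda>l. v l + s * S a l)"
  have wF: "w \<in> fun_vs.span (S ` F)"
  proof -
    have "v + (\<lambda>l. s * S a l) \<in> fun_vs.span (S ` F)"
      using a(1) by (intro fun_vs.span_add[OF v] fun_vs.span_scale fun_vs.span_base) auto
    then show ?thesis by (simp add: w_def plus_fun_def)
  qed
  have wk: "w k = 0"
    using k(2) apos[OF k(1)] by (simp add: w_def)
  have wnn: "0 \<le> w l" if l: "l \<in> Q" "?G \<subseteq> Z l" for l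
  proof (cases "F \<subseteq> Z l")
    case True
    then show ?thesis using realized_span_vanish[OF S FP l(1) True wF] by simp
  next
    case False
    then have "l \<in> J" using l by (simp add: J_def)
    then show ?thesis using sge[of l] apos[of l] by (simp add: w_def field_simps)
  qed
  \<comment> \<open>Lifting with \<open>H = ?G\<close> lands in the cone of
    \<open>F \<inter> Z k\<close>, which lies in \<open>?G\<close>. The added point is itself in the
    span of \<open>?G\<close> and can be subtracted again.\<close>
  obtain N where N: "(\<lambda>l. w l + N * (\<Sum>i\<in>?G. S i l)) \<in> row_cone S (F \<inter> Z k)"
    using slack_lift[OF S sl F _ wF wnn _ _ wk] k(1) unfolding J_def by blast
  have "(\<lambda>l. w l + N * (\<Sum>i\<in>?G. S i l)) \<in> fun_vs.span (S ` ?G)"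
    using row_cone_mono[OF fG FJ[OF k(1)] N] row_cone_subset_span[OF fG] by blast
  moreover have "(\<lambda>l. N * (\<Sum>i\<in>?G. S i l)) \<in> fun_vs.span (S ` ?G)"
    using fG by (auto simp: in_row_span_iff sum_distrib_left)
  ultimately have "(\<lambda>l. w l + N * (\<Sum>i\<in>?G. S i l)) - (\<lambda>l. N * (\<Sum>i\<in>?G. S i l)) \<in> fun_vs.span (S ` ?G)"
    by (rule fun_vs.span_diff)
  moreover have "(\<lambda>l. w l + N * (\<Sum>i\<in>?G. S i l)) - (\<lambda>l. N * (\<Sum>i\<in>?G. S i l)) = w"
    by (simp add: fun_eq_iff)
  ultimately have wG: "w \<in> fun_vs.span (S ` ?G)" by simp
  have "w j = 0"
    using realized_span_vanish[OF S _ jQ _ wG] FP by blast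
  then have "s = 0"
    using vj apos[OF J(2)] by (simp add: w_def)
  then show ?thesis using wG by (simp add: w_def)
qed

text \<open>Subtracting a multiple of one row off the facet makes column \<open>j\<close> zero, and
  the remainder lies in the span of the facet by \<open>slack_facet_span\<close>.\<close>

lemma slack_dim_facet:
  assumes S: "realized_by S" and sl: "slack_rows P Q S" and F: "face F" and j: "facet F j"
  shows "fun_vs.dim (S ` F) \<le> fun_vs.dim (S ` (F \<inter> Z j)) + 1"
proof -
  let ?G = "F \<inter> Z j"
  have jQ: "j \<in> Q" using j by (rule facet_in_Q)
  have FP: "F \<subseteq> P" and fG: "finite ?G"
    using face_subset[OF F] face_finite[OF F] by auto
  obtain a where a: "a \<in> F" "a \<notin> Z j"
    using j unfolding facet_def by blast
  have apos: "0 < S a j"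
    using realized_pos[OF S _ jQ a(2)] a(1) FP by blast
  have "S ` F \<subseteq> fun_vs.span (insert (S a) (S ` ?G))"
  proof
    fix x assume "x \<in> S ` F"
    define c where "c = x j / S a j"
    have "x - (\<lambda>l. c * S a l) \<in> fun_vs.span (S ` F)"
      using \<open>x \<in> S ` F\<close> a(1) by (intro fun_vs.span_diff fun_vs.span_scale fun_vs.span_base) auto
    then have "x - (\<lambda>l. c * S a l) \<in> fun_vs.span (S ` ?G)"
      using apos by (intro slack_facet_span[OF S sl F j]) (auto simp: c_def)
    then show "x \<in> fun_vs.span (insert (S a) (S ` ?G))"
      by (auto simp: fun_vs.span_insert)
  qed
  then have "fun_vs.dim (S ` F) \<le> fun_vs.dim (insert (S a) (S ` ?G))"
    using fG by (intro fun_vs.dim_mono_finite) auto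
  also have "\<dots> = fun_vs.dim (S ` ?G) + 1"
    using realized_span_vanish[OF S _ jQ, of ?G "S a"] FP apos fG
    by (intro fun_vs.dim_insert_notin_span) auto
  finally show ?thesis .
qed

text \<open>The face \<open>F \<inter> Z j \<inter> Z j'\<close> of codimension two in \<open>F\<close> lies on a second facet of \<open>F\<close>.\<close>

lemma slack_diamond:
  assumes S: "realized_by S" and sl: "slack_rows P Q S" and F: "face F" and j: "facet F j"
    and j': "facet (F \<inter> Z j) j'"
  obtains k where "facet F k" "F \<inter> Z j \<inter> Z k = F \<inter> Z j \<inter> Z j'"
proof -
  define G where "G = F \<inter> Z j"
  define H where "H = G \<inter> Z j'"
  have jQ: "j \<in> Q" "j' \<in> Q" using j j' facet_in_Q by auto
  have FP: "F \<subseteq> P" using face_subset[OF F] .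
  have G: "face G" and HF: "face H" and H: "H \<subseteq> F"
    using face_Int F jQ by (auto simp: G_def H_def)
  obtain a where a: "a \<in> F" "a \<notin> Z j"
    using j unfolding facet_def by blast
  obtain h where h: "h \<in> F" "h \<in> Z j" "h \<notin> Z j'"
    using j' unfolding facet_def by blast
  define J where "J = {k \<in> Q. H \<subseteq> Z k \<and> h \<notin> Z k}"
  have J: "finite J" "j' \<in> J"
    using finite_Q jQ h unfolding J_def H_def by auto
  have hpos: "0 < S h k" if "k \<in> J" for k
    using that h FP by (intro realized_pos[OF S]) (auto simp: J_def)
  \<comment> \<open>Ratio test: the largest \<open>s\<close> that keeps \<open>S a - s * S h\<close>
    nonnegative in every column vanishing on \<open>H\<close>. It is tight at \<open>k\<close>, the
    column of the second facet.\<close>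
  define s where "s = Min ((\<lambda>k. S a k / S h k) ` J)"
  have "s \<in> (\<lambda>k. S a k / S h k) ` J"
    unfolding s_def using J by (intro Min_in) auto
  then obtain k where k: "k \<in> J" "s = S a k / S h k" by blast
  have sle: "s \<le> S a l / S h l" if "l \<in> J" for l
    unfolding s_def using J that by (intro Min_le) auto
  define w where "w = (\<lambda>l. S a l - s * S h l)"
  have kQ: "k \<in> Q" "H \<subseteq> Z k" "h \<notin> Z k" using k(1) by (auto simp: J_def)
  have wF: "w \<in> fun_vs.span (S ` F)"
  proof -
    have "S a - (\<lambda>l. s * S h l) \<in> fun_vs.span (S ` F)"
      using h a(1) by (intro fun_vs.span_diff fun_vs.span_scale fun_vs.span_base) auto
    then show ?thesis by (simp add: w_def fun_diff_def)
  qed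
  have wk: "w k = 0"
    using k(2) hpos[OF k(1)] by (simp add: w_def)
  have wnn: "0 \<le> w l" if l: "l \<in> Q" "H \<subseteq> Z l" for l
  proof (cases "h \<in> Z l")
    case True
    then have "S h l = 0"
      using realized_zero[OF S _ l(1)] h(1) FP by blast
    then show ?thesis
      using realized_nonneg[OF S _ l(1)] a(1) FP by (auto simp: w_def)
  next
    case False
    then have "l \<in> J" using l by (simp add: J_def)
    then show ?thesis using sle[of l] hpos[of l] by (simp add: w_def field_simps)
  qed
  obtain N where N: "(\<lambda>l. w l + N * (\<Sum>i\<in>H. S i l)) \<in> row_cone S (F \<inter> Z k)"
    using slack_lift[OF S sl F H wF wnn kQ(1,2) wk] .
  \<comment> \<open>Otherwise the lifted vector, being in the span of \<open>F \<inter> Z k\<close>,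
    would vanish in column \<open>j\<close>, where its value is \<open>S a j > 0\<close>.\<close>
  obtain i where i: "i \<in> F" "i \<in> Z k" "i \<notin> Z j"
  proof (rule ccontr)
    assume "\<not> thesis"
    then have sub: "F \<inter> Z k \<subseteq> Z j" using that by blast
    have "finite (F \<inter> Z k)" using face_finite[OF F] by simp
    then have "(\<lambda>l. w l + N * (\<Sum>i\<in>H. S i l)) \<in> fun_vs.span (S ` (F \<inter> Z k))"
      using N row_cone_subset_span by blast
    then have "w j + N * (\<Sum>i\<in>H. S i j) = 0"
      using realized_span_vanish[OF S _ jQ(1) sub] FP by blast
    moreover have "(\<Sum>i\<in>H. S i j) = 0"
      using realized_zero[OF S _ jQ(1)] FP by (intro sum.neutral) (auto simp: H_def G_def)
    moreover have "w j = S a j"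
      using realized_zero[OF S _ jQ(1) h(2)] h(1) FP by (auto simp: w_def)
    ultimately show False
      using realized_pos[OF S _ jQ(1) a(2)] a(1) FP by fastforce
  qed
  \<comment> \<open>\<open>Z k\<close> contains \<open>H\<close> but misses \<open>h\<close>, so it
    cuts \<open>G\<close> properly; maximality of the facet \<open>H\<close> of \<open>G\<close>
    gives equality.\<close>
  have GH: "G \<inter> Z k = H"
    using j' kQ h unfolding facet_def G_def[symmetric] H_def using G_def by blast
  have "facet F k"
    unfolding facet_def
  proof (intro conjI ballI impI)
    fix l assume l: "l \<in> Q" "F \<inter> Z k \<subseteq> Z l" "\<not> F \<subseteq> Z l"
    show "F \<inter> Z l \<subseteq> Z k"
    proof (rule ccontr)
      \<comment> \<open>The chain from \<open>H\<close> through \<open>F \<inter> Z k\<close> and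
        \<open>F \<inter> Z l\<close> to \<open>F\<close> would raise the dimension by three, but
        the descent through \<open>G\<close> allows only two.\<close>
      assume nl: "\<not> F \<inter> Z l \<subseteq> Z k"
      have "fun_vs.dim (S ` H) + 1 \<le> fun_vs.dim (S ` (F \<inter> Z k))"
        using i kQ(2) H by (intro dim_face_less[OF S HF face_Int[OF F kQ(1)]]) (auto simp: H_def G_def)
      moreover have "fun_vs.dim (S ` (F \<inter> Z k)) + 1 \<le> fun_vs.dim (S ` (F \<inter> Z l))"
        using nl l by (intro dim_face_less[OF S face_Int[OF F kQ(1)] face_Int[OF F l(1)]]) auto
      moreover have "fun_vs.dim (S ` (F \<inter> Z l)) + 1 \<le> fun_vs.dim (S ` F)"
        using l by (intro dim_face_less[OF S face_Int[OF F l(1)] F]) auto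
      moreover have "fun_vs.dim (S ` F) \<le> fun_vs.dim (S ` G) + 1"
        using slack_dim_facet[OF S sl F j] by (simp add: G_def)
      moreover have "fun_vs.dim (S ` G) \<le> fun_vs.dim (S ` H) + 1"
        using slack_dim_facet[OF S sl G] j' by (simp add: G_def H_def)
      ultimately show False by linarith
    qed
  qed (use kQ h in auto)
  then show ?thesis
    using that GH unfolding G_def H_def by blast
qed

section \<open>Comparing dimensions of two realizations on each face\<close>

lemma realized_dim_zero:
  assumes R: "realized_by R" and F: "face F" and triv: "\<And>k. k \<in> Q \<Longrightarrow> F \<subseteq> Z k"
  shows "x \<in> fun_vs.span (R ` F) \<Longrightarrow> x = 0" and "fun_vs.dim (R ` F) = 0"
proof -
  have "R i = 0" if "i \<in> F" for i
  proof
    fix j show "R i j = 0 j"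
      using that triv R face_subset[OF F] unfolding realized_by_def zero_fun_apply by blast
  qed
  then have sub: "R ` F \<subseteq> fun_vs.span {}" by auto
  then show "fun_vs.dim (R ` F) = 0"
    using fun_vs.dim_le_card[OF sub] by simp
  show "x = 0" if "x \<in> fun_vs.span (R ` F)"
    using that fun_vs.span_minimal[OF sub fun_vs.subspace_span] by auto
qed

text \<open>Descend from \<open>F\<close> to a facet: the dimension drops by at most one in
  \<open>S\<close> and by at least one in \<open>M\<close>.\<close>

lemma slack_dim_le:
  assumes S: "realized_by S" and sl: "slack_rows P Q S" and M: "realized_by M"
  shows "face F \<Longrightarrow> fun_vs.dim (S ` F) \<le> fun_vs.dim (M ` F)"
proof (induction "card F" arbitrary: F rule: less_induct)
  case less
  note F = \<open>face F\<close>
  show ?case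
  proof (cases "\<exists>k\<in>Q. \<not> F \<subseteq> Z k")
    case False
    then show ?thesis using realized_dim_zero(2)[OF S F] by auto
  next
    case True
    then obtain j where j: "facet F j" using facet_exists by blast
    have G: "face (F \<inter> Z j)" and GF: "F \<inter> Z j \<subset> F"
      using face_Int[OF F facet_in_Q[OF j]] j by (auto simp: facet_def)
    have "fun_vs.dim (S ` (F \<inter> Z j)) \<le> fun_vs.dim (M ` (F \<inter> Z j))"
      using less.hyps[OF psubset_card_mono[OF face_finite[OF F] GF] G] .
    then show ?thesis
      using slack_dim_facet[OF S sl F j] dim_face_less[OF M G F GF] by linarith
  qed
qed

text \<open>The dimensions in \<open>M\<close> grow by at least one along every chain of faces, those in \<open>S\<close> by exactly
  one, and the two agree at the top.\<close>

lemma dim_le_slack: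
  assumes S: "realized_by S" and sl: "slack_rows P Q S" and M: "realized_by M"
    and dim: "fun_vs.dim (M ` P) \<le> fun_vs.dim (S ` P)"
  shows "face F \<Longrightarrow> fun_vs.dim (M ` F) \<le> fun_vs.dim (S ` F)"
proof (induction "card (P - F)" arbitrary: F rule: less_induct)
  case less
  note F = \<open>face F\<close>
  show ?case
  proof (cases "F = P")
    case True
    then show ?thesis using dim by simp
  next
    case False
    \<comment> \<open>The induction runs upwards, through a minimal face \<open>F'\<close> strictly
      above \<open>F\<close>.\<close>
    let ?A = "{F'. face F' \<and> F \<subset> F'}"
    have "finite ?A"
      using finite_P face_subset by (intro finite_subset[of ?A "Pow P"]) auto
    moreover have "P \<in> ?A"
      using False face_P face_subset[OF F] by auto
    ultimately obtain F' where "F' \<in> ?A" and F'_min: "\<forall>B\<in>?A. B \<subseteq> F' \<longrightarrow> F' = B"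
      by (rule finite_has_minimal2[elim_format]) blast
    then have F': "face F'" "F \<subset> F'" by auto
    have min: "B = F'" if "face B" "F \<subset> B" "B \<subseteq> F'" for B
      using F'_min that by blast
    obtain j a where j: "j \<in> Q" "F \<subseteq> Z j" "a \<in> F'" "a \<notin> Z j"
      using face_psubset_separated[OF F F'] .
    \<comment> \<open>By minimality of \<open>F'\<close>, each such column cuts exactly
      \<open>F\<close> out of \<open>F'\<close>, so \<open>F\<close> is a facet of
      \<open>F'\<close>.\<close>
    have meet: "F' \<inter> Z k = F" if k: "k \<in> Q" "F \<subseteq> Z k" "\<not> F' \<subseteq> Z k" for k
    proof (rule ccontr)
      assume "F' \<inter> Z k \<noteq> F"
      then have "F' \<inter> Z k = F'"
        using F'(2) k(2) by (intro min face_Int[OF F'(1) k(1)]) auto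
      then show False using k(3) by blast
    qed
    have eq: "F' \<inter> Z j = F" using meet j by blast
    have facet: "facet F' j"
      unfolding facet_def eq using j meet by auto
    have "P - F' \<subset> P - F"
      using F'(2) face_subset[OF F'(1)] by blast
    then have "card (P - F') < card (P - F)"
      using finite_P by (intro psubset_card_mono) auto
    then have "fun_vs.dim (M ` F') \<le> fun_vs.dim (S ` F')"
      using less.hyps F'(1) by blast
    then show ?thesis
      using slack_dim_facet[OF S sl F'(1) facet] dim_face_less[OF M F F'] unfolding eq by linarith
  qed
qed

text \<open>Subtract from \<open>x\<close> the largest multiple of a row that keeps all facet columns nonnegative. This
  lands in the span of a facet \<open>G\<close>; by the diamond property each facet column of \<open>G\<close> is on the span
  of \<open>G\<close> a positive multiple of a facet column of \<open>F\<close>, so induction applies to \<open>G\<close>.\<close>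

lemma slack_transfer_face:
  assumes S: "realized_by S" and sl: "slack_rows P Q S" and M: "realized_by M"
    and dim: "fun_vs.dim (M ` P) \<le> fun_vs.dim (S ` P)"
  shows "face F \<Longrightarrow> x \<in> fun_vs.span (M ` F) \<Longrightarrow> (\<And>j. facet F j \<Longrightarrow> 0 \<le> x j) \<Longrightarrow> x \<in> row_cone M F"
proof (induction "card F" arbitrary: F x rule: less_induct)
  case less
  note F = \<open>face F\<close> and x = \<open>x \<in> fun_vs.span (M ` F)\<close> and xnn = less.prems(3)
  have FP: "F \<subseteq> P" using face_subset[OF F] .
  \<comment> \<open>Pass from \<open>M\<close> to \<open>S\<close> on \<open>E\<close>, descend to
    the facet in \<open>S\<close>, and return to \<open>M\<close>.\<close>
  have dim_facet: "fun_vs.dim (M ` E) \<le> fun_vs.dim (M ` (E \<inter> Z l)) + 1"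
    if E: "face E" and l: "facet E l" for E l
    using dim_le_slack[OF S sl M dim E] slack_dim_facet[OF S sl E l]
      slack_dim_le[OF S sl M face_Int[OF E facet_in_Q[OF l]]] by linarith
  show ?case
  proof (cases "\<exists>k\<in>Q. \<not> F \<subseteq> Z k")
    case False
    then have "x = 0" using realized_dim_zero(1)[OF M F _ x] by blast
    then show ?thesis
      unfolding row_cone_def by (auto intro!: exI[of _ "\<lambda>_. 0"] simp: fun_eq_iff)
  next
    case True
    then obtain j1 where j1: "facet F j1" using facet_exists by blast
    then obtain a where a: "a \<in> F" "a \<notin> Z j1" unfolding facet_def by blast
    \<comment> \<open>Only facet columns in which row \<open>a\<close> is positive limit the
      multiple of it that can be subtracted.\<close>
    define T where "T = {j. facet F j \<and> a \<notin> Z j}"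
    have T: "finite T" "j1 \<in> T"
      using j1 a finite_subset[OF _ finite_Q, of T] facet_in_Q by (auto simp: T_def)
    have apos: "0 < M a j" if "j \<in> T" for j
      using that a(1) FP facet_in_Q by (intro realized_pos[OF M]) (auto simp: T_def)
    define t where "t = Min ((\<lambda>j. x j / M a j) ` T)"
    have "t \<in> (\<lambda>j. x j / M a j) ` T"
      unfolding t_def using T by (intro Min_in) auto
    then obtain j where j: "j \<in> T" "t = x j / M a j" by blast
    have tle: "t \<le> x l / M a l" if "l \<in> T" for l
      unfolding t_def using T that by (intro Min_le) auto
    have jF: "facet F j" using j(1) by (simp add: T_def)
    have t0: "0 \<le> t" using j apos[OF j(1)] xnn[OF jF] by simp
    define y where "y = (\<lambda>l. x l - t * M a l)"
    define G where "G = F \<inter> Z j"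
    have G: "face G" and GF: "G \<subset> F"
      using face_Int[OF F facet_in_Q[OF jF]] jF by (auto simp: facet_def G_def)
    have ynn: "0 \<le> y l" if l: "facet F l" for l
    proof (cases "l \<in> T")
      case True
      then show ?thesis using tle[of l] apos[of l] by (simp add: y_def field_simps)
    next
      case False
      then have "M a l = 0"
        using l realized_zero[OF M _ facet_in_Q[OF l]] a(1) FP by (auto simp: T_def)
      then show ?thesis using xnn[OF l] by (simp add: y_def)
    qed
    have "x - (\<lambda>l. t * M a l) \<in> fun_vs.span (M ` F)"
      using a(1) by (intro fun_vs.span_diff[OF x] fun_vs.span_scale fun_vs.span_base) auto
    then have "y \<in> fun_vs.span (M ` F)"
      by (simp add: y_def fun_diff_def)
    moreover have "y j = 0" using j(2) apos[OF j(1)] by (simp add: y_def)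
    ultimately have yG: "y \<in> fun_vs.span (M ` G)"
      unfolding G_def by (intro facet_span_of_dim[OF M F jF dim_facet[OF F jF]])
    have "y \<in> row_cone M G"
    proof (rule less.hyps[OF psubset_card_mono[OF face_finite[OF F] GF] G yG])
      fix j' assume j': "facet G j'"
      obtain k where k: "facet F k" "G \<inter> Z k = G \<inter> Z j'"
        using slack_diamond[OF S sl F jF] j' unfolding G_def by blast
      have Q: "j' \<in> Q" "k \<in> Q" using j' k(1) facet_in_Q by auto
      obtain h where h: "h \<in> G" "h \<notin> Z j'"
        using j' unfolding facet_def by blast
      have hk: "h \<notin> Z k" using h k(2) by blast
      have hP: "h \<in> P" using h(1) face_subset[OF G] by blast
      \<comment> \<open>Modulo the span of \<open>G \<inter> Z j'\<close>, \<open>y\<close> is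
        \<open>c\<close> times row \<open>h\<close>. Columns \<open>j'\<close> and \<open>k\<close>
        both vanish on that span and are positive at \<open>h\<close>, so the sign of
        \<open>y k\<close> decides that of \<open>y j'\<close>.\<close>
      obtain c where c: "(\<lambda>l. y l - c * M h l) \<in> fun_vs.span (M ` (G \<inter> Z j'))"
        using facet_span_decompose[OF M G Q(1) h dim_facet[OF G j'] yG] .
      have HP: "G \<inter> Z j' \<subseteq> P" using face_subset[OF G] by blast
      have "y j' - c * M h j' = 0" "y k - c * M h k = 0"
        using realized_span_vanish[OF M HP Q(1) _ c] realized_span_vanish[OF M HP Q(2) _ c] k(2)
        by auto
      moreover have "0 < M h j'" "0 < M h k"
        using realized_pos[OF M hP Q(1) h(2)] realized_pos[OF M hP Q(2) hk] by auto
      moreover have "0 \<le> y k" using ynn[OF k(1)] .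
      ultimately have "0 \<le> c" by (simp add: zero_le_mult_iff)
      then show "0 \<le> y j'"
        using \<open>y j' - c * M h j' = 0\<close> \<open>0 < M h j'\<close> by simp
    qed
    then have "y \<in> row_cone M F"
      using row_cone_mono[OF face_finite[OF F]] GF by blast
    then have "(\<lambda>l. y l + t * M a l) \<in> row_cone M F"
      using row_cone_add_scaled_row[OF face_finite[OF F] a(1)] t0 by blast
    then show ?thesis by (simp add: y_def)
  qed
qed

lemma slack_rows_transfer:
  assumes "realized_by S" and "slack_rows P Q S" and "realized_by M"
    and "fun_vs.dim (M ` P) \<le> fun_vs.dim (S ` P)"
  shows "slack_rows P Q M"
  unfolding slack_rows_def
  using slack_transfer_face[OF assms face_P] facet_in_Q by blast

end

section \<open>Rank and row space\<close>

text \<open>The zero padding meets the convention of \<open>realized_by\<close> outside the column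
  range.\<close>

definition row_fun :: "real mat \<Rightarrow> nat \<Rightarrow> nat \<Rightarrow> real" where
  "row_fun M i j = (if j < dim_col M then M $$ (i,j) else 0)"

text \<open>Columns of the product lie in the column space of \<open>C\<close>, so the exchange
  lemma bounds independent sets of them by the number of columns of \<open>C\<close>.\<close>

lemma (in vec_space) rank_mult_le:
  assumes C: "C \<in> carrier_mat n r" and D: "D \<in> carrier_mat r q"
  shows "rank (C * D) \<le> r"
proof -
  let ?M = "C * D"
  have M: "?M \<in> carrier_mat n q" using C D by simp
  obtain U where U: "finite U" "maximal U (\<lambda>T. T \<subseteq> set (cols ?M) \<and> lin_indpt T)"
    using maximal_exists_superset[of "set (cols ?M)" "\<lambda>T. T \<subseteq> set (cols ?M) \<and> lin_indpt T" "{}"]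
    using finite_lin_indpt2 by auto
  have Uc: "U \<subseteq> set (cols ?M)" and Ui: "lin_indpt U"
    using U(2) by (auto simp: maximal_def)
  have Cc: "set (cols C) \<subseteq> carrier_vec n" using C cols_dim by blast
  have "set (cols ?M) \<subseteq> span (set (cols C))"
  proof
    fix v assume "v \<in> set (cols ?M)"
    then obtain j where j: "j < q" "v = col ?M j"
      using M by (auto simp: cols_def)
    have "v = C *\<^sub>v col D j" using j(2) col_mult2[OF C D j(1)] by (rule trans)
    moreover have "C *\<^sub>v col D j \<in> col_space C"
      unfolding col_space_eq[OF C] using C D by (auto intro!: bexI[of _ "col D j"])
    ultimately show "v \<in> span (set (cols C))" by (simp add: col_space_def)
  qed
  then have "U \<subseteq> span (set (cols C))" using Uc by blast
  moreover have "U \<subseteq> carrier_vec n" using Uc M cols_dim by blast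
  ultimately obtain W :: "'a vec set" where "int (card W) \<le> int (card (set (cols C))) - int (card U)"
    using replacement[of U "set (cols C)"] U(1) Cc Ui by auto
  then have "card U \<le> card (set (cols C))" by linarith
  also have "\<dots> \<le> r" using C card_length[of "cols C"] by simp
  finally show ?thesis using rank_card_indpt[OF M U(2)] by simp
qed

text \<open>\<open>C\<close> collects a maximal independent set of columns of \<open>M\<close>; by
  maximality it spans the others.\<close>

lemma (in vec_space) rank_factorization:
  assumes M: "M \<in> carrier_mat n q"
  obtains C D where "C \<in> carrier_mat n (rank M)" "D \<in> carrier_mat (rank M) q" "M = C * D"
proof -
  obtain U where U: "finite U" "maximal U (\<lambda>T. T \<subseteq> set (cols M) \<and> lin_indpt T)"
    using maximal_exists_superset[of "set (cols M)" "\<lambda>T. T \<subseteq> set (cols M) \<and> lin_indpt T" "{}"]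
    using finite_lin_indpt2 by auto
  have Uc: "U \<subseteq> set (cols M)" and Ui: "lin_indpt U"
    using U(2) by (auto simp: maximal_def)
  have Mc: "set (cols M) \<subseteq> carrier_vec n" using M cols_dim by blast
  have Un: "U \<subseteq> carrier_vec n" using Uc Mc by blast
  have rk: "rank M = card U" using rank_card_indpt[OF M U(2)] .
  obtain us where us: "set us = U" "distinct us" using finite_distinct_list[OF U(1)] by blast
  define C where "C = mat_of_cols n us"
  have C: "C \<in> carrier_mat n (rank M)"
    using us rk distinct_card unfolding C_def by fastforce
  have cC: "cols C = us" unfolding C_def using us Un by simp
  have "\<exists>x. x \<in> carrier_vec (rank M) \<and> col M j = C *\<^sub>v x" if j: "j < q" for j
  proof -
    have v: "col M j \<in> set (cols M)" using j M by (auto simp: cols_def)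
    have "col M j \<in> span U"
    proof (cases "col M j \<in> U")
      case True
      then show ?thesis using span_mem Un by blast
    next
      case False
      have "lin_dep (U \<union> {col M j})"
      proof (rule ccontr)
        assume "\<not> ?thesis"
        then have "U \<union> {col M j} = U"
          using U(2) v Uc unfolding maximal_def by blast
        then show False using False by blast
      qed
      then show ?thesis
        using lin_dep_iff_in_span[OF _ Ui _ False] Un v Mc by auto
    qed
    then have "col M j \<in> col_space C" by (simp add: col_space_def cC us(1))
    then show ?thesis unfolding col_space_eq[OF C] using C by auto
  qed
  then obtain f where f: "\<And>j. j < q \<Longrightarrow> f j \<in> carrier_vec (rank M)"
      "\<And>j. j < q \<Longrightarrow> col M j = C *\<^sub>v f j"
    by metis
  define D where "D = mat_of_cols (rank M) (map f [0..<q])"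
  have D: "D \<in> carrier_mat (rank M) q" unfolding D_def by (auto simp: mat_of_cols_def)
  have "M = C * D"
  proof (rule mat_col_eqI)
    fix j assume "j < dim_col (C * D)"
    then have j: "j < q" using D by simp
    then have "col D j = f j" unfolding D_def using f(1)[OF j] by simp
    then show "col M j = col (C * D) j" using f(2)[OF j] col_mult2[OF C D j] by simp
  qed (use M C D in auto)
  then show ?thesis using that C D by blast
qed

text \<open>Transposing a rank factorization keeps its inner dimension.\<close>

lemma rank_transpose_le:
  fixes M :: "'a :: field mat"
  assumes M: "M \<in> carrier_mat p q"
  shows "vec_space.rank q M\<^sup>T \<le> vec_space.rank p M"
proof -
  obtain C D where CD: "C \<in> carrier_mat p (vec_space.rank p M)"
      "D \<in> carrier_mat (vec_space.rank p M) q" "M = C * D"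
    using vec_space.rank_factorization[OF M] .
  have "M\<^sup>T = D\<^sup>T * C\<^sup>T" using CD transpose_mult by metis
  then show ?thesis
    using vec_space.rank_mult_le[of "D\<^sup>T" q "vec_space.rank p M" "C\<^sup>T" p] CD by simp
qed

lemma rank_transpose:
  fixes M :: "'a :: field mat"
  assumes M: "M \<in> carrier_mat p q"
  shows "vec_space.rank q M\<^sup>T = vec_space.rank p M"
  using rank_transpose_le[OF M] rank_transpose_le[of "M\<^sup>T" q p] M by (simp add: order_antisym)

section \<open>Cancellation and row bases\<close>

lemma vec_diff_eq_zeroD:
  fixes x y :: "'a :: ab_group_add vec"
  assumes x: "x \<in> carrier_vec d" and y: "y \<in> carrier_vec d" and eq: "x - y = 0\<^sub>v d"
  shows "x = y"
proof (rule eq_vecI)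
  fix k assume "k < dim_vec y"
  then have k: "k < d" using carrier_vecD[OF y] by simp
  then have "(x - y) $ k = x $ k - y $ k" using carrier_vecD[OF y] by simp
  then show "x $ k = y $ k" using eq k by simp
qed (simp add: carrier_vecD[OF x] carrier_vecD[OF y])

text \<open>The rows of \<open>T\<close> are linearly independent; equivalently, the lineality space
  of the cone of all \<open>x\<close> with nonnegative products with the columns of \<open>T\<close>
  is zero.\<close>

definition left_injective :: "real mat \<Rightarrow> bool" where
  "left_injective T \<longleftrightarrow>
    (\<forall>x \<in> carrier_vec (dim_row T). (\<forall>j < dim_col T. x \<bullet> col T j = 0) \<longrightarrow> x = 0\<^sub>v (dim_row T))"

lemma left_injective_cancel:
  assumes T: "left_injective T" "T \<in> carrier_mat d q"
    and X: "X \<in> carrier_mat m d" and Y: "Y \<in> carrier_mat m d" and eq: "X * T = Y * T"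
  shows "X = Y"
proof (rule eq_rowI)
  fix i assume "i < dim_row Y"
  then have i: "i < m" using Y by simp
  let ?x = "row X i - row Y i"
  have rX: "row X i \<in> carrier_vec d" and rY: "row Y i \<in> carrier_vec d"
    using X Y i by auto
  have "?x \<bullet> col T j = 0" if j: "j < q" for j
  proof -
    have "row X i \<bullet> col T j = row Y i \<bullet> col T j"
      using arg_cong[OF eq, of "\<lambda>N. N $$ (i,j)"] X Y T(2) i j by simp
    moreover have "col T j \<in> carrier_vec d" using T(2) j by simp
    ultimately show ?thesis using rX rY by (simp add: minus_scalar_prod_distrib)
  qed
  then have "?x = 0\<^sub>v d"
    using T rX rY unfolding left_injective_def by auto
  then show "row X i = row Y i"
    by (rule vec_diff_eq_zeroD[OF rX rY])
qed (use X Y in auto)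

text \<open>\<open>E\<close> selects a basis among the rows and \<open>C\<close> holds the
  coordinates. Having \<open>E * M\<close> as right factor turns any combination of its rows into
  one of the rows of \<open>M\<close>.\<close>

lemma row_factorization:
  fixes M :: "real mat"
  defines "d \<equiv> fun_vs.dim (row_fun M ` {..<dim_row M})"
  obtains C E where "C \<in> carrier_mat (dim_row M) d" "E \<in> carrier_mat d (dim_row M)"
    "M = C * (E * M)" "left_injective (E * M)"
proof -
  let ?p = "dim_row M" and ?q = "dim_col M"
  obtain B where B: "B \<subseteq> row_fun M ` {..<?p}" "fun_vs.independent B"
      "row_fun M ` {..<?p} \<subseteq> fun_vs.span B" "card B = d"
    using fun_vs.basis_exists unfolding d_def by blast
  have fB: "finite B" using B(1) finite_subset by blast
  obtain g where g: "bij_betw g {..<d} B"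
    using ex_bij_betw_nat_finite[OF fB] B(4) by (auto simp: atLeast0LessThan)
  then have gB: "g ` {..<d} = B" and ginj: "inj_on g {..<d}"
    by (auto simp: bij_betw_def)
  have "\<forall>k\<in>{..<d}. \<exists>i<?p. g k = row_fun M i" using gB B(1) by blast
  then obtain f where f: "\<And>k. k < d \<Longrightarrow> f k < ?p \<and> g k = row_fun M (f k)"
    unfolding Ball_def lessThan_iff by metis
  define E :: "real mat" where "E = mat d ?p (\<lambda>(k,i). if i = f k then 1 else 0)"
  have E: "E \<in> carrier_mat d ?p" by (simp add: E_def)
  have EM: "(E * M) $$ (k,j) = g k j" if k: "k < d" and j: "j < ?q" for k j
  proof -
    have "(E * M) $$ (k,j) = (\<Sum>i\<in>{0..<?p}. (if i = f k then 1 else 0) * M $$ (i,j))"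
      using k j by (simp add: E_def scalar_prod_def)
    also have "\<dots> = (\<Sum>i\<in>{0..<?p}. if i = f k then M $$ (i,j) else 0)"
      by (rule sum.cong) auto
    also have "\<dots> = M $$ (f k, j)" using f[OF k] by simp
    finally show ?thesis using f[OF k] j by (simp add: row_fun_def)
  qed
  have "\<forall>i\<in>{..<?p}. \<exists>u. row_fun M i = (\<lambda>j. \<Sum>k<d. u k * g k j)"
    using B(3) in_row_span_iff[of "{..<d}" _ g] unfolding gB by blast
  then obtain u where u: "\<And>i. i < ?p \<Longrightarrow> row_fun M i = (\<lambda>j. \<Sum>k<d. u i k * g k j)"
    unfolding Ball_def lessThan_iff by metis
  define C where "C = mat ?p d (\<lambda>(i,k). u i k)"
  have C: "C \<in> carrier_mat ?p d" by (simp add: C_def)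
  have "M = C * (E * M)"
  proof (rule eq_matI)
    fix i j assume "i < dim_row (C * (E * M))" "j < dim_col (C * (E * M))"
    then have ij: "i < ?p" "j < ?q" using C by auto
    have "(C * (E * M)) $$ (i,j) = (\<Sum>k\<in>{0..<d}. u i k * (E * M) $$ (k,j))"
      using ij C E by (simp add: C_def scalar_prod_def)
    also have "\<dots> = (\<Sum>k\<in>{0..<d}. u i k * g k j)"
      using EM ij by (intro sum.cong) auto
    also have "\<dots> = row_fun M i j" using u[OF ij(1)] by (simp add: atLeast0LessThan)
    finally show "M $$ (i,j) = (C * (E * M)) $$ (i,j)" using ij by (simp add: row_fun_def)
  qed (use C in auto)
  moreover have "left_injective (E * M)"
    unfolding left_injective_def
  proof (intro ballI impI)
    fix x :: "real vec"
    assume x: "x \<in> carrier_vec (dim_row (E * M))"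
      and x0: "\<forall>j<dim_col (E * M). x \<bullet> col (E * M) j = 0"
    have xd: "x \<in> carrier_vec d" using x E by simp
    \<comment> \<open>Independence speaks of sets of vectors, so the coordinates of \<open>x\<close>
      are attached to the basis vectors through the inverse enumeration.\<close>
    define c where "c = (\<lambda>b. x $ (the_inv_into {..<d} g b))"
    have ck: "c (g k) = x $ k" if "k < d" for k
      using that ginj by (simp add: c_def the_inv_into_f_f)
    have "(\<Sum>b\<in>B. (\<lambda>j. c b * b j)) = (\<Sum>k<d. (\<lambda>j. c (g k) * g k j))"
      using sum.reindex[OF ginj, of "\<lambda>b j. c b * b j"] by (simp add: gB)
    also have "\<dots> = 0"
    proof
      fix j
      have "(\<Sum>k<d. (\<lambda>j. c (g k) * g k j)) j = (\<Sum>k<d. x $ k * g k j)"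
        unfolding sum_fun_apply using ck by (intro sum.cong) auto
      also have "\<dots> = 0"
      proof (cases "j < ?q")
        case True
        have "(\<Sum>k<d. x $ k * g k j) = (\<Sum>k\<in>{0..<d}. x $ k * (E * M) $$ (k,j))"
          using EM True by (intro sum.cong) auto
        also have "\<dots> = x \<bullet> col (E * M) j"
          using E True by (simp add: scalar_prod_def)
        finally show ?thesis using x0 True by simp
      next
        case False
        then show ?thesis using f by (intro sum.neutral) (auto simp: row_fun_def)
      qed
      finally show "(\<Sum>k<d. (\<lambda>j. c (g k) * g k j)) j = 0 j" by simp
    qed
    finally have z: "(\<Sum>b\<in>B. (\<lambda>j. c b * b j)) = 0" .
    have "x $ k = 0" if k: "k < d" for k
      using fun_vs.independentD[OF B(2) fB subset_refl z, of "g k"] gB k ck[OF k] by auto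
    then show "x = 0\<^sub>v (dim_row (E * M))"
      using xd E by (intro eq_vecI) auto
  qed
  ultimately show ?thesis using that C E by blast
qed

text \<open>Each kind of factorization bounds the other rank: \<open>row_factorization\<close> has
  inner dimension \<open>?d\<close>, and the \<open>?r\<close> rows of the right factor of a rank
  factorization span the rows of \<open>M\<close>.\<close>

lemma rank_eq_dim_rows:
  "vec_space.rank (dim_row M) M = fun_vs.dim (row_fun M ` {..<dim_row M})" (is "?r = ?d")
proof (rule antisym)
  obtain C E where "C \<in> carrier_mat (dim_row M) ?d" "E \<in> carrier_mat ?d (dim_row M)"
    "M = C * (E * M)"
    using row_factorization .
  then show "?r \<le> ?d"
    by (metis carrier_mat_triv mult_carrier_mat vec_space.rank_mult_le)
  have M: "M \<in> carrier_mat (dim_row M) (dim_col M)" by simp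
  obtain C D where CD: "C \<in> carrier_mat (dim_row M) ?r"
      "D \<in> carrier_mat ?r (dim_col M)" "M = C * D"
    using vec_space.rank_factorization[OF M] .
  have "row_fun M ` {..<dim_row M} \<subseteq> fun_vs.span (row_fun D ` {..<?r})"
  proof clarsimp
    fix i assume i: "i < dim_row M"
    have "row_fun M i j = (\<Sum>k<?r. C $$ (i,k) * row_fun D k j)" for j
    proof (cases "j < dim_col M")
      case True
      have "row_fun M i j = (C * D) $$ (i,j)"
        using True CD(3) by (simp add: row_fun_def)
      also have "\<dots> = (\<Sum>k\<in>{0..<?r}. C $$ (i,k) * D $$ (k,j))"
        using True i CD(1,2) by (simp add: scalar_prod_def)
      also have "\<dots> = (\<Sum>k<?r. C $$ (i,k) * row_fun D k j)"
        using True CD(2) by (intro sum.cong) (auto simp: row_fun_def)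
      finally show ?thesis .
    next
      case False
      then show ?thesis using CD(2) by (simp add: row_fun_def)
    qed
    then have "row_fun M i = (\<lambda>j. \<Sum>k<?r. C $$ (i,k) * row_fun D k j)" by blast
    then show "row_fun M i \<in> fun_vs.span (row_fun D ` {..<?r})"
      unfolding in_row_span_iff[OF finite_lessThan] by (rule exI[of _ "\<lambda>k. C $$ (i,k)"])
  qed
  then have "?d \<le> card (row_fun D ` {..<?r})"
    by (intro fun_vs.dim_le_card) auto
  also have "\<dots> \<le> ?r" using card_image_le[of "{..<?r}"] by simp
  finally show "?d \<le> ?r" .
qed

section \<open>Slack matrices\<close>

lemma transpose_mult_scalar_col:
  fixes A B :: "real mat"
  assumes A: "A \<in> carrier_mat p n" and B: "B \<in> carrier_mat n q"
    and y: "y \<in> carrier_vec p" and j: "j < q"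
  shows "(A\<^sup>T *\<^sub>v y) \<bullet> col B j = (\<Sum>i<p. y $ i * row_fun (A * B) i j)"
proof -
  have "(A\<^sup>T *\<^sub>v y) \<bullet> col B j = y \<bullet> (A *\<^sub>v col B j)"
    using A B y j by (intro transpose_vec_mult_scalar) auto
  also have "A *\<^sub>v col B j = col (A * B) j"
    using col_mult2[OF A B j] by simp
  also have "y \<bullet> col (A * B) j = (\<Sum>i<p. y $ i * row_fun (A * B) i j)"
    using A B j by (auto simp: scalar_prod_def row_fun_def atLeast0LessThan intro!: sum.cong)
  finally show ?thesis .
qed

lemma col_transpose_in_cone:
  fixes A :: "real mat"
  assumes A: "A \<in> carrier_mat p n" and i: "i < p"
    and K: "K = {A\<^sup>T *\<^sub>v y | y. y \<in> carrier_vec p \<and> (\<forall>i<p. y $ i \<ge> 0)}"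
  shows "col A\<^sup>T i \<in> K"
proof -
  have "col A\<^sup>T i = A\<^sup>T *\<^sub>v unit_vec p i"
    using A i by (intro eq_vecI) (auto simp: scalar_prod_right_unit)
  then show ?thesis
    unfolding K by (intro CollectI exI[of _ "unit_vec p i"]) (auto simp: i)
qed

text \<open>The cone contains its generators, the columns of \<open>A\<^sup>T\<close>, and lies in
  their span.\<close>

lemma cone_dim_generated:
  fixes A :: "real mat"
  assumes A: "A \<in> carrier_mat p n"
    and K: "K = {A\<^sup>T *\<^sub>v y | y. y \<in> carrier_vec p \<and> (\<forall>i<p. y $ i \<ge> 0)}"
  shows "vec_space.cone_dim n K = vec_space.rank p A"
proof -
  interpret vec_space "TYPE(real)" n .
  have At: "A\<^sup>T \<in> carrier_mat n p" using A by simp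
  have cA: "set (cols A\<^sup>T) \<subseteq> carrier_vec n" using cols_dim At by blast
  have "K \<subseteq> col_space A\<^sup>T"
    unfolding K col_space_eq[OF At] using A by auto
  then have "span K \<subseteq> span (set (cols A\<^sup>T))"
    using cA span_subsetI unfolding col_space_def by blast
  moreover have "set (cols A\<^sup>T) \<subseteq> K"
    using col_transpose_in_cone[OF A _ K] A by (auto simp: cols_def)
  then have "span (set (cols A\<^sup>T)) \<subseteq> span K"
    by (rule span_is_monotone)
  ultimately have "span K = span (set (cols A\<^sup>T))" by simp
  then have "cone_dim K = rank A\<^sup>T"
    unfolding cone_dim_def rank_def by simp
  then show ?thesis using rank_transpose[OF A] by simp
qed

section \<open>Slack matrices versus the slack property of rows\<close>

lemma slack_matrix_nonneg:
  assumes "slack_matrix_of n K S" and "i < dim_row S" and "j < dim_col S"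
  shows "0 \<le> S $$ (i,j)"
proof -
  obtain A B where A: "A \<in> carrier_mat (dim_row S) n" and B: "B \<in> carrier_mat n (dim_col S)"
    and K: "K = {x \<in> carrier_vec n. \<forall>j<dim_col S. x \<bullet> col B j \<ge> 0}"
      "K = {A\<^sup>T *\<^sub>v y | y. y \<in> carrier_vec (dim_row S) \<and> (\<forall>i<dim_row S. y $ i \<ge> 0)}"
    and S: "S = A * B"
    using assms(1) unfolding slack_matrix_of_def by blast
  \<comment> \<open>Row \<open>i\<close> of \<open>A\<close> is a generator and hence satisfies the
    inequalities.\<close>
  have "col A\<^sup>T i \<in> K"
    using col_transpose_in_cone[OF A assms(2) K(2)] .
  then have "0 \<le> col A\<^sup>T i \<bullet> col B j"
    using assms(3) unfolding K(1) by blast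
  also have "col A\<^sup>T i \<bullet> col B j = (A * B) $$ (i,j)"
    using A B assms(2,3) by simp
  finally show ?thesis using S by simp
qed

text \<open>A nonnegative row combination comes from a point satisfying the inequalities; the
  generator description rewrites this point with nonnegative coefficients.\<close>

lemma slack_matrix_slack_rows:
  assumes "slack_matrix_of n K S"
  shows "slack_rows {..<dim_row S} {..<dim_col S} (row_fun S)"
  unfolding slack_rows_def
proof (intro ballI impI)
  let ?p = "dim_row S" and ?q = "dim_col S"
  fix x assume x: "x \<in> fun_vs.span (row_fun S ` {..<?p})" and xnn: "\<forall>j\<in>{..<?q}. 0 \<le> x j"
  obtain A B where A: "A \<in> carrier_mat ?p n" and B: "B \<in> carrier_mat n ?q"
    and K: "K = {x \<in> carrier_vec n. \<forall>j<?q. x \<bullet> col B j \<ge> 0}"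
      "K = {A\<^sup>T *\<^sub>v y | y. y \<in> carrier_vec ?p \<and> (\<forall>i<?p. y $ i \<ge> 0)}"
    and S: "S = A * B"
    using assms unfolding slack_matrix_of_def by blast
  have prod: "(A\<^sup>T *\<^sub>v y) \<bullet> col B j = (\<Sum>i<?p. y $ i * row_fun S i j)"
    if "y \<in> carrier_vec ?p" "j < ?q" for y j
    using transpose_mult_scalar_col[OF A B that] S by simp
  obtain u where u: "x = (\<lambda>j. \<Sum>i<?p. u i * row_fun S i j)"
    using x by (auto simp: in_row_span_iff)
  define v where "v = A\<^sup>T *\<^sub>v vec ?p u"
  have vx: "v \<bullet> col B j = x j" if "j < ?q" for j
    unfolding v_def u using prod[OF _ that, of "vec ?p u"] by simp
  then have "v \<in> K"
    using xnn A unfolding K(1) by (auto simp: v_def)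
  then obtain y where y: "v = A\<^sup>T *\<^sub>v y" "y \<in> carrier_vec ?p" "\<forall>i<?p. y $ i \<ge> 0"
    unfolding K(2) by blast
  have "x j = (\<Sum>i<?p. y $ i * row_fun S i j)" for j
  proof (cases "j < ?q")
    case True
    then show ?thesis using prod[OF y(2) True] vx y(1) by simp
  next
    case False
    then show ?thesis unfolding u by (simp add: row_fun_def)
  qed
  then have "x = (\<lambda>j. \<Sum>i<?p. y $ i * row_fun S i j)" by blast
  then show "x \<in> row_cone (row_fun S) {..<?p}"
    unfolding row_cone_def using y(3) by (intro CollectI exI[of _ "\<lambda>i. y $ i"]) auto
qed

text \<open>Pointedness makes \<open>B\<close> cancellable, so a factorization of
  \<open>S = A * B\<close> through its row basis passes to \<open>A\<close> and bounds the rank of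
  \<open>A\<close>.\<close>

lemma pointed_cone_dim_le:
  assumes sl: "slack_matrix_of n K S" and pt: "pointed_cone n K"
  shows "vec_space.cone_dim n K \<le> fun_vs.dim (row_fun S ` {..<dim_row S})" (is "_ \<le> ?d")
proof -
  let ?p = "dim_row S" and ?q = "dim_col S"
  obtain A B where A: "A \<in> carrier_mat ?p n" and B: "B \<in> carrier_mat n ?q"
    and K: "K = {x \<in> carrier_vec n. \<forall>j<?q. x \<bullet> col B j \<ge> 0}"
      "K = {A\<^sup>T *\<^sub>v y | y. y \<in> carrier_vec ?p \<and> (\<forall>i<?p. y $ i \<ge> 0)}"
    and S: "S = A * B"
    using sl unfolding slack_matrix_of_def by blast
  have "left_injective B"
    unfolding left_injective_def
  proof (intro ballI impI)
    fix x :: "real vec" assume "x \<in> carrier_vec (dim_row B)" "\<forall>j<dim_col B. x \<bullet> col B j = 0"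
    then have x: "x \<in> carrier_vec n" "\<forall>j<?q. x \<bullet> col B j = 0" using B by auto
    then have "x \<in> K" "- x \<in> K" unfolding K(1) using B by auto
    then show "x = 0\<^sub>v (dim_row B)" using pt B unfolding pointed_cone_def by auto
  qed
  moreover obtain C E where CE: "C \<in> carrier_mat ?p ?d" "E \<in> carrier_mat ?d ?p" "S = C * (E * S)"
    using row_factorization .
  have "A * B = C * (E * A) * B"
    using CE A B S by (smt (verit) assoc_mult_mat mult_carrier_mat)
  ultimately have "A = C * (E * A)"
    using A B CE by (intro left_injective_cancel[of B n ?q A ?p]) auto
  then have "vec_space.rank ?p A \<le> ?d"
    using vec_space.rank_mult_le[of C ?p ?d "E * A" n] CE A by simp
  then show ?thesis using cone_dim_generated[OF A K(2)] by simp
qed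

lemma slack_rows_pointed_cone:
  assumes nn: "\<forall>i < dim_row M. \<forall>j < dim_col M. M $$ (i,j) \<ge> 0"
    and sl: "slack_rows {..<dim_row M} {..<dim_col M} (row_fun M)"
  shows "\<exists>n K. slack_matrix_of n K M \<and> polyhedral_cone n K \<and> pointed_cone n K \<and>
    vec_space.cone_dim n K = vec_space.rank (dim_row M) M"
proof -
  let ?p = "dim_row M" and ?q = "dim_col M"
  define d where "d = vec_space.rank ?p M"
  obtain C E where C: "C \<in> carrier_mat ?p d" and E: "E \<in> carrier_mat d ?p"
    and M: "M = C * (E * M)" and inj: "left_injective (E * M)"
    using row_factorization[of M] unfolding d_def rank_eq_dim_rows by blast
  define T where "T = E * M"
  have T: "T \<in> carrier_mat d ?q" and MCT: "M = C * T" and injT: "left_injective T"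
    using E M inj by (auto simp: T_def)
  define K where "K = {x \<in> carrier_vec d. \<forall>j<?q. x \<bullet> col T j \<ge> 0}"
  have prod: "(C\<^sup>T *\<^sub>v y) \<bullet> col T j = (\<Sum>i<?p. y $ i * row_fun M i j)"
    if "y \<in> carrier_vec ?p" "j < ?q" for y j
    using transpose_mult_scalar_col[OF C T that] MCT by simp
  have K: "K = {C\<^sup>T *\<^sub>v y | y. y \<in> carrier_vec ?p \<and> (\<forall>i<?p. y $ i \<ge> 0)}" (is "_ = ?R")
  proof
    show "?R \<subseteq> K"
    proof clarify
      fix y :: "real vec" assume y: "y \<in> carrier_vec ?p" "\<forall>i<?p. 0 \<le> y $ i"
      have "0 \<le> (C\<^sup>T *\<^sub>v y) \<bullet> col T j" if "j < ?q" for j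
        unfolding prod[OF y(1) that] using y(2) nn that
        by (intro sum_nonneg mult_nonneg_nonneg) (auto simp: row_fun_def)
      moreover have "C\<^sup>T *\<^sub>v y \<in> carrier_vec d" using C y(1) by simp
      ultimately show "C\<^sup>T *\<^sub>v y \<in> K" by (auto simp: K_def)
    qed
    show "K \<subseteq> ?R"
    proof
      fix x assume "x \<in> K"
      then have x: "x \<in> carrier_vec d" and xnn: "\<And>j. j < ?q \<Longrightarrow> 0 \<le> x \<bullet> col T j"
        by (auto simp: K_def)
      \<comment> \<open>The products of \<open>x\<close> with the columns of
        \<open>T = E * M\<close>, written as a combination of rows of \<open>M\<close> so that the
        slack property applies.\<close>
      define z where "z = (\<lambda>j. \<Sum>i<?p. (E\<^sup>T *\<^sub>v x) $ i * row_fun M i j)"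
      have zx: "z j = x \<bullet> col T j" if j: "j < ?q" for j
      proof -
        have "x \<bullet> col T j = x \<bullet> (E *\<^sub>v col M j)"
          unfolding T_def using E j by (subst col_mult2) auto
        also have "\<dots> = (E\<^sup>T *\<^sub>v x) \<bullet> col M j"
          using E j x by (intro transpose_vec_mult_scalar[symmetric]) auto
        also have "\<dots> = z j"
          using j unfolding z_def
          by (auto simp: scalar_prod_def row_fun_def atLeast0LessThan intro!: sum.cong)
        finally show ?thesis by simp
      qed
      have "z \<in> fun_vs.span (row_fun M ` {..<?p})"
        unfolding in_row_span_iff[OF finite_lessThan] z_def
        by (rule exI[of _ "\<lambda>i. (E\<^sup>T *\<^sub>v x) $ i"]) simp
      then have "z \<in> row_cone (row_fun M) {..<?p}"
        using sl xnn zx unfolding slack_rows_def by auto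
      then obtain u where u: "\<forall>i<?p. 0 \<le> u i" "z = (\<lambda>j. \<Sum>i<?p. u i * row_fun M i j)"
        unfolding row_cone_def by auto
      define y where "y = vec ?p u"
      have y: "y \<in> carrier_vec ?p" "\<forall>i<?p. 0 \<le> y $ i" using u(1) by (auto simp: y_def)
      have Cy: "C\<^sup>T *\<^sub>v y \<in> carrier_vec d" using C y by simp
      \<comment> \<open>\<open>x\<close> and the generated point have equal products with all
        columns of \<open>T\<close>, hence agree.\<close>
      have "(x - C\<^sup>T *\<^sub>v y) \<bullet> col T j = 0" if j: "j < ?q" for j
      proof -
        have "(C\<^sup>T *\<^sub>v y) \<bullet> col T j = z j"
          unfolding prod[OF y(1) j] u(2) by (simp add: y_def)
        moreover have "col T j \<in> carrier_vec d" using T j by auto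
        ultimately show ?thesis using zx[OF j] x Cy by (simp add: minus_scalar_prod_distrib)
      qed
      moreover have "x - C\<^sup>T *\<^sub>v y \<in> carrier_vec d" using x Cy by simp
      ultimately have "x - C\<^sup>T *\<^sub>v y = 0\<^sub>v d"
        using injT T unfolding left_injective_def by auto
      then have "x = C\<^sup>T *\<^sub>v y"
        by (rule vec_diff_eq_zeroD[OF x Cy])
      then show "x \<in> ?R" using y by blast
    qed
  qed
  have "slack_matrix_of d K M"
    unfolding slack_matrix_of_def using C T K MCT K_def by blast
  moreover have "polyhedral_cone d K"
    unfolding polyhedral_cone_def using T K_def by blast
  moreover have "pointed_cone d K"
    unfolding pointed_cone_def
  proof (intro equalityI subsetI)
    fix x assume "x \<in> {x \<in> K. - x \<in> K}"
    then have x: "x \<in> carrier_vec d" and nnx: "\<forall>j<?q. x \<bullet> col T j \<ge> 0" "\<forall>j<?q. (- x) \<bullet> col T j \<ge> 0"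
      by (auto simp: K_def)
    have "x \<bullet> col T j = 0" if j: "j < ?q" for j
    proof -
      have "col T j \<in> carrier_vec d" using T j by auto
      then have "(- x) \<bullet> col T j = - (x \<bullet> col T j)"
        by (rule uminus_scalar_prod[OF x, symmetric])
      then show ?thesis using nnx j by fastforce
    qed
    then show "x \<in> {0\<^sub>v d}"
      using injT T x unfolding left_injective_def by auto
  next
    fix x :: "real vec" assume "x \<in> {0\<^sub>v d}"
    moreover have "- 0\<^sub>v d = (0\<^sub>v d :: real vec)" by auto
    moreover have "0\<^sub>v d \<in> K" using T by (auto simp: K_def)
    ultimately show "x \<in> {x \<in> K. - x \<in> K}" by auto
  qed
  moreover have "vec_space.cone_dim d K = d"
  proof -
    \<comment> \<open>\<open>C\<close> has full rank \<open>d\<close>: factoring \<open>C\<close>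
      through its rank \<open>r\<close> also factors \<open>M\<close> through \<open>r\<close>, so
      \<open>d \<le> r\<close>.\<close>
    define r where "r = vec_space.rank ?p C"
    obtain C1 D1 where CD: "C1 \<in> carrier_mat ?p r" "D1 \<in> carrier_mat r d" "C = C1 * D1"
      using vec_space.rank_factorization[OF C] unfolding r_def by blast
    have "C1 * (D1 * T) = C1 * D1 * T"
      by (rule assoc_mult_mat[OF CD(1,2) T, symmetric])
    also have "\<dots> = M"
      unfolding CD(3)[symmetric] by (rule MCT[symmetric])
    finally have CDT: "C1 * (D1 * T) = M" .
    have "vec_space.rank ?p (C1 * (D1 * T)) \<le> r"
      using CD T by (intro vec_space.rank_mult_le) auto
    then have "d \<le> vec_space.rank ?p C"
      unfolding CDT d_def r_def .
    moreover have "vec_space.rank ?p C \<le> d"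
      using vec_space.rank_le_nc[OF C] .
    ultimately show ?thesis using cone_dim_generated[OF C K] by simp
  qed
  ultimately show ?thesis unfolding d_def by blast
qed

theorem theorem4p3:
  fixes M :: "real mat"
  assumes "\<forall>i < dim_row M. \<forall>j < dim_col M. M $$ (i,j) \<ge> 0"
    and "vec_space.rank (dim_row M) M \<ge> 2"
  shows "is_slack_matrix M \<longleftrightarrow>
    (\<exists>n K. polyhedral_cone n K \<and> pointed_cone n K \<and>
       vec_space.cone_dim n K = vec_space.rank (dim_row M) M \<and>
       incidence_matrix_of n K (inc_mat M))"
proof
  assume "is_slack_matrix M"
  then have "slack_rows {..<dim_row M} {..<dim_col M} (row_fun M)"
    unfolding is_slack_matrix_def using slack_matrix_slack_rows by blast
  from slack_rows_pointed_cone[OF assms(1) this]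
  show "\<exists>n K. polyhedral_cone n K \<and> pointed_cone n K \<and>
       vec_space.cone_dim n K = vec_space.rank (dim_row M) M \<and>
       incidence_matrix_of n K (inc_mat M)"
    unfolding incidence_matrix_of_def by blast
next
  assume "\<exists>n K. polyhedral_cone n K \<and> pointed_cone n K \<and>
       vec_space.cone_dim n K = vec_space.rank (dim_row M) M \<and>
       incidence_matrix_of n K (inc_mat M)"
  then obtain n K S where pt: "pointed_cone n K"
    and dim: "vec_space.cone_dim n K = vec_space.rank (dim_row M) M"
    and S: "slack_matrix_of n K S" and inc: "inc_mat M = inc_mat S"
    unfolding incidence_matrix_of_def by blast
  have dims: "dim_row S = dim_row M" "dim_col S = dim_col M"
    using arg_cong[OF inc, of dim_row] arg_cong[OF inc, of dim_col] by (auto simp: inc_mat_def)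
  have zero: "S $$ (i,j) = 0 \<longleftrightarrow> M $$ (i,j) = 0" if ij: "i < dim_row M" "j < dim_col M" for i j
    using arg_cong[OF inc, of "\<lambda>N. N $$ (i,j)"] ij dims
    by (simp add: inc_mat_def split: if_splits)
  \<comment> \<open>The pattern is read off \<open>M\<close>; by \<open>zero\<close>,
    \<open>S\<close> realizes it as well.\<close>
  interpret incidence "{..<dim_row M}" "{..<dim_col M}" "\<lambda>j. {i. M $$ (i,j) = 0}"
    by unfold_locales auto
  have "slack_rows {..<dim_row M} {..<dim_col M} (row_fun M)"
  proof (rule slack_rows_transfer)
    show "realized_by (row_fun S)"
      using slack_matrix_nonneg[OF S] zero dims by (auto simp: realized_by_def row_fun_def)
    show "slack_rows {..<dim_row M} {..<dim_col M} (row_fun S)"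
      using slack_matrix_slack_rows[OF S] dims by simp
    show "realized_by (row_fun M)"
      using assms(1) by (auto simp: realized_by_def row_fun_def)
    \<comment> \<open>Here the dimension of the cone enters: it equals the rank of \<open>M\<close>,
      and pointedness bounds it by the row rank of \<open>S\<close>.\<close>
    show "fun_vs.dim (row_fun M ` {..<dim_row M}) \<le> fun_vs.dim (row_fun S ` {..<dim_row M})"
      using pointed_cone_dim_le[OF S pt] dim dims rank_eq_dim_rows[of M] by simp
  qed
  then show "is_slack_matrix M"
    using slack_rows_pointed_cone[OF assms(1)] unfolding is_slack_matrix_def by blast
qed

end
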